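(* Let $n\ge1$, let $K,L\in\mathcal{K}^n_0$ be polytopes and $p\in[-\infty,1]$. Then $\overline{M}_p(K,L)$ and $\underline{M}_{-p}(K,L)$ are also polytopes. More precisely, \[ \overline{M}_p(K,L)=\left\{x\in\mathbb{R}^n : a^Tx\le m_p(h_K(a),h_L(a))\text{ for all } a\in\bigcup_{N_K\in\mathcal{N}_K,\,N_L\in\mathcal{N}_L}\mathrm{ray}(N_K\cap N_L)\right\} \] and \[ \underline{M}_{-p}(K,L)=\mathrm{conv}\left(\left\{m_{-p}(\|v\|_K^{-1},\|v\|_L^{-1})\,v : v\in\bigcup_{F_K\in\mathcal{F}_K,\,F_L\in\mathcal{F}_L}\mathrm{ray}(F_K\cap F_L)\right\}\right). \]
   Context: $\mathcal{K}^n_0$ denotes the set of compact convex subsets of $\mathbb{R}^n$ containing the origin in their interior. For $C\in\mathcal{K}^n_0$, $h_C(a)=\sup\{a^Tx : x\in C\}$ is the support function and $\|x\|_C=\inf\{\lambda\ge 0 : x\in\lambda C\}$ the gauge function. For $x,y>0$, $m_p(x,y)=\left(\frac{x^p+y^p}{2}\right)^{1/p}$ if $p\in\mathbb{R}\setminus\{0\}$, $m_0(x,y)=\sqrt{xy}$, $m_{-\infty}(x,y)=\min\{x,y\}$, $m_\infty(x,y)=\max\{x,y\}$. $\mathbb{S}_2$ is the Euclidean unit sphere in $\mathbb{R}^n$. For $K,L\in\mathcal{K}^n_0$ and $p\in[-\infty,\infty]$, the upper $p$-mean is \[ \overline{M}_p(K,L)=\{x\in\mathbb{R}^n : a^Tx\le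 m_p(h_K(a),h_L(a)) \text{ for all } a\in\mathbb{S}_2\}, \] and the lower $p$-mean is \[ \underline{M}_p(K,L)=\mathrm{conv}\left(\left\{m_p(\|v\|_K^{-1},\|v\|_L^{-1})\,v : v\in\mathbb{S}_2\right\}\right). \] For a polytope $P\in\mathcal{K}^n_0$ and $x\in P$, $N_P(x)=\{a\in\mathbb{R}^n : a^Tx=h_P(a)\}$ is the cone of outer normals of $x$ with respect to $P$, and $\mathrm{ext}(P)$ is the set of extreme points of $P$. The coarse normal fan of $P$ is $\mathcal{N}_P=\{N_P(x) : x\in\mathrm{ext}(P)\}$, and the coarse face fan is $\mathcal{F}_P=\{\mathrm{pos}(F) : F\text{ is a facet of }P\}$, where $\mathrm{pos}$ denotes the positive hull (the convex cone with apex $0$ generated by the set). For a cone $C\subset\mathbb{R}^n$, $\mathrm{ray}(C)$ is the set of Euclidean unit vectors generating the extreme rays of $C$. *)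

theory Defs
  imports "HOL-Analysis.Analysis"
begin

definition convex_bodies0 :: "('a::euclidean_space) set set" where
  "convex_bodies0 = {C. compact C \<and> convex C \<and> 0 \<in> interior C}"

(* Only meant for x, y > 0. *)
definition pmean :: "ereal \<Rightarrow> real \<Rightarrow> real \<Rightarrow> real" where
  "pmean p x y =
     (if p = -\<infinity> then min x y
      else if p = \<infinity> then max x y
      else if p = 0 then sqrt (x * y)
      else ((x powr real_of_ereal p + y powr real_of_ereal p) / 2) powr (1 / real_of_ereal p))"

definition support_fun :: "('a::euclidean_space) set \<Rightarrow> 'a \<Rightarrow> real" where
  "support_fun C a = (SUP x\<in>C. a \<bullet> x)"

definition gauge_fun :: "('a::euclidean_space) set \<Rightarrow> 'a \<Rightarrow> real" where
  "gauge_fun C x = Inf {l. 0 \<le> l \<and> x \<in> (\<lambda>y. l *\<^sub>R y) ` C}"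

definition upper_pmean :: "ereal \<Rightarrow> ('a::euclidean_space) set \<Rightarrow> 'a set \<Rightarrow> 'a set" where
  "upper_pmean p K L =
     {x. \<forall>a\<in>sphere 0 1. a \<bullet> x \<le> pmean p (support_fun K a) (support_fun L a)}"

definition lower_pmean :: "ereal \<Rightarrow> ('a::euclidean_space) set \<Rightarrow> 'a set \<Rightarrow> 'a set" where
  "lower_pmean p K L =
     convex hull ((\<lambda>v. pmean p (inverse (gauge_fun K v)) (inverse (gauge_fun L v)) *\<^sub>R v) ` sphere 0 1)"

definition normal_cone :: "('a::euclidean_space) set \<Rightarrow> 'a \<Rightarrow> 'a set" where
  "normal_cone P x = {a. a \<bullet> x = support_fun P a}"

definition coarse_normal_fan :: "('a::euclidean_space) set \<Rightarrow> 'a set set" where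
  "coarse_normal_fan P = {normal_cone P x | x. x extreme_point_of P}"

definition coarse_face_fan :: "('a::euclidean_space) set \<Rightarrow> 'a set set" where
  "coarse_face_fan P = {convex_cone hull F | F. F facet_of P}"

(* An extreme ray of C is a half-line emanating from 0 that is a face of C;
   conic hull {u} is the half-line {c *\<^sub>R u | c. 0 \<le> c}. *)
definition extreme_rays :: "('a::euclidean_space) set \<Rightarrow> 'a set" where
  "extreme_rays C = {u. norm u = 1 \<and> (conic hull {u}) face_of C}"

end

theory Submission
  imports Defs
begin

text \<open>Support functions and gauge functions of polytopes are positive away from \<open>0\<close> and piecewise linear:
  \<open>support_fun P\<close> is linear on each cone of the normal fan, where a single vertex attains it, and
  \<open>gauge_fun P\<close> is linear on each cone of the face fan, where it is the functional cutting out the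
  facet (\<open>linear_fan_support_fun\<close>, \<open>linear_fan_gauge_fun\<close>).  So both halves of the theorem are about
  two positive functions \<open>f\<close>, \<open>g\<close> that are linear on the cones of two finite fans, hence both linear
  on every cone of the common refinement.

  For \<open>p \<le> 1\<close> the mean \<open>pmean p\<close> is concave and positively homogeneous, hence superadditive.  With
  \<open>\<phi> v = pmean p (f v) (g v)\<close>, every vector \<open>v\<close> of a refined cone is a nonnegative combination
  \<open>v = (\<Sum>t. c t *\<^sub>R t)\<close> of the unit generators of its extreme rays, and superadditivity gives
  \<open>(\<Sum>t. c t * \<phi> t) \<le> \<phi> v\<close> (\<open>pmean_ray_decomposition\<close>).  This one inequality yields both formulas:
  the constraint \<open>v \<bullet> x \<le> \<phi> v\<close> is implied by the constraints \<open>t \<bullet> x \<le> \<phi> t\<close>, and the point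
  \<open>v /\<^sub>R \<phi> v\<close> is a combination of the points \<open>t /\<^sub>R \<phi> t\<close> with nonnegative weights of total at most 1,
  which is a convex combination once \<open>0\<close> is known to lie in the hull of those points.  The second
  reading applies to the lower mean because the \<open>(- p)\<close>-mean of reciprocals is the reciprocal of the
  \<open>p\<close>-mean.  Both sets are polytopes because there are only finitely many rays.\<close>

section \<open>Concavity and duality of the power means\<close>

lemma powr_ge_tangent_at_1:
  fixes r q :: real
  assumes "r > 0" and "q \<ge> 1 \<or> q \<le> 0"
  shows "1 + q * (r - 1) \<le> r powr q"
proof -
  have "q * 1 powr (q - 1) * (r - 1) \<le> r powr q - 1 powr q"
  proof (rule f''_imp_f'[where C = "{0<..}" and f = "\<lambda>x. x powr q" and f' = "\<lambda>x. q * x powr (q - 1)" and f'' = "\<lambda>x. q * ((q - 1) * x powr (q - 2))"])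
    show "((\<lambda>x. x powr q) has_real_derivative q * x powr (q - 1)) (at x)" if "x \<in> {0<..}" for x :: real
      using that by (auto intro!: derivative_eq_intros)
    show "((\<lambda>x. q * x powr (q - 1)) has_real_derivative q * ((q - 1) * x powr (q - 2))) (at x)"
      if "x \<in> {0<..}" for x :: real
      using that by (auto intro!: derivative_eq_intros)
    show "0 \<le> q * ((q - 1) * x powr (q - 2))" for x
    proof (cases "q \<ge> 1")
      case False
      with assms(2) show ?thesis
        by (intro mult_nonpos_nonpos mult_nonpos_nonneg) auto
    qed simp
  qed (use assms in auto)
  then show ?thesis by simp
qed

lemma pmean_pos:
  assumes "x > 0" "y > 0"
  shows "pmean p x y > 0"
proof -
  have "x powr r + y powr r > 0" for r
    using assms by (intro add_pos_pos) auto
  then have "x powr r + y powr r \<noteq> 0" for r by (simp add: less_le)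
  with assms show ?thesis by (auto simp: pmean_def min_def max_def)
qed

text \<open>A concave function that is homogeneous of degree 1 lies below its tangent planes, and these pass
  through the origin, so no constant term appears.  Having the linear majorant in hand turns
  superadditivity for any finite sum into a termwise comparison, without Jensen's inequality.

  For a real exponent \<open>r\<close>, put \<open>m = pmean r x y\<close> and \<open>M = pmean r x0 y0\<close>, and write the normalised
  pairs as \<open>a = (x / m) powr r\<close> and \<open>A = (x0 / M) powr r\<close>, similarly \<open>b\<close> and \<open>B\<close> for the second
  entries.  Then \<open>a + b = A + B = 2\<close>, and adding the tangent-line inequality for \<open>z powr (1 / r)\<close> at
  \<open>z = 1\<close> for the quotients \<open>a / A\<close> and \<open>b / B\<close>, with weights \<open>A\<close> and \<open>B\<close>, cancels the first-order terms.\<close>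

lemma pmean_tangent:
  assumes p: "p \<le> 1" and "x0 > 0" "y0 > 0"
  obtains \<alpha> \<beta> where "pmean p x0 y0 = \<alpha> * x0 + \<beta> * y0"
    and "\<And>x y. x > 0 \<Longrightarrow> y > 0 \<Longrightarrow> pmean p x y \<le> \<alpha> * x + \<beta> * y"
proof -
  consider "p = -\<infinity>" | "p = 0" | r where "p = ereal r" "r \<noteq> 0" "r \<le> 1"
    using p by (cases p) (auto simp: zero_ereal_def one_ereal_def)
  then show thesis
  proof cases
    case 1
    show thesis
    proof (cases "x0 \<le> y0")
      case True
      then show thesis using 1 by (intro that[of 1 0]) (auto simp: pmean_def)
    next
      case False
      then show thesis using 1 by (intro that[of 0 1]) (auto simp: pmean_def)
    qed
  next
    case 2
    \<comment> \<open>AM-GM applied to \<open>t * x\<close> and \<open>y / t\<close> is sharp at \<open>(x0, y0)\<close> exactly if \<open>t\<^sup>2 = y0 / x0\<close>.\<close>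
    define t where "t = sqrt (y0 / x0)"
    have t: "t > 0" "t\<^sup>2 = y0 / x0" using assms by (auto simp: t_def)
    show thesis
    proof (rule that[of "t / 2" "1 / (2 * t)"])
      have y0: "y0 = t\<^sup>2 * x0" using t assms by simp
      have "sqrt (x0 * y0) = t * x0"
        by (rule real_sqrt_unique) (use assms t(1) in \<open>auto simp: y0 power2_eq_square\<close>)
      then show "pmean p x0 y0 = t / 2 * x0 + 1 / (2 * t) * y0"
        using 2 t(1) by (simp add: pmean_def y0 power2_eq_square)
      show "pmean p x y \<le> t / 2 * x + 1 / (2 * t) * y" if "x > 0" "y > 0" for x y
        using arith_geo_mean_sqrt[of "t * x" "y / t"] that 2 t by (simp add: pmean_def field_simps)
    qed
  next
    case 3
    define M where "M = pmean p x0 y0"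
    define A where "A = x0 powr r / M powr r"
    define B where "B = y0 powr r / M powr r"
    have M: "M > 0" unfolding M_def using assms by (intro pmean_pos)
    have powr_pmean: "pmean p x y powr r = (x powr r + y powr r) / 2" if "x > 0" "y > 0" for x y
      using 3 that by (simp add: pmean_def powr_powr add_pos_pos)
    have A: "A > 0" "B > 0" using assms M by (auto simp: A_def B_def)
    have AB: "A + B = 2"
    proof -
      have "x0 powr r + y0 powr r = 2 * M powr r"
        using powr_pmean[OF assms(2,3)] by (simp add: M_def)
      then show ?thesis using M by (simp add: A_def B_def flip: add_divide_distrib)
    qed
    show thesis
    proof (rule that[of "A * M / (2 * x0)" "B * M / (2 * y0)"])
      have "A * M / (2 * x0) * x0 + B * M / (2 * y0) * y0 = (A + B) * M / 2"
        using assms by (simp add: field_simps)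
      then show "pmean p x0 y0 = A * M / (2 * x0) * x0 + B * M / (2 * y0) * y0"
        using AB by (simp add: M_def)
    next
      fix x y :: real assume xy: "x > 0" "y > 0"
      define m where "m = pmean p x y"
      define a where "a = x powr r / m powr r"
      define b where "b = y powr r / m powr r"
      have m: "m > 0" unfolding m_def using xy by (intro pmean_pos)
      have ab: "a > 0" "b > 0" using xy m by (auto simp: a_def b_def)
      have ab2: "a + b = 2"
      proof -
        have "x powr r + y powr r = 2 * m powr r"
          using powr_pmean[OF xy] by (simp add: m_def)
        then show ?thesis using m by (simp add: a_def b_def flip: add_divide_distrib)
      qed
      \<comment> \<open>The condition \<open>r \<le> 1\<close> is what makes \<open>z powr (1 / r)\<close> convex.\<close>
      have q: "1 / r \<ge> 1 \<or> 1 / r \<le> 0" using 3 by (auto simp: field_simps)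
      have "A * (1 + 1 / r * (a / A - 1)) \<le> A * (a / A) powr (1 / r)"
        using powr_ge_tangent_at_1[of "a / A", OF _ q] A ab by (intro mult_left_mono) auto
      moreover have "B * (1 + 1 / r * (b / B - 1)) \<le> B * (b / B) powr (1 / r)"
        using powr_ge_tangent_at_1[of "b / B", OF _ q] A ab by (intro mult_left_mono) auto
      moreover have "A * (1 + 1 / r * (a / A - 1)) + B * (1 + 1 / r * (b / B - 1)) = A + B + 1 / r * ((a + b) - (A + B))"
        using A 3 by (simp add: field_simps)
      moreover have "(a / A) powr (1 / r) = x * M / (m * x0)"
        using 3 xy assms M m by (simp add: a_def A_def powr_divide powr_powr powr_mult)
      moreover have "(b / B) powr (1 / r) = y * M / (m * y0)"
        using 3 xy assms M m by (simp add: b_def B_def powr_divide powr_powr powr_mult)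
      ultimately have "2 \<le> A * (x * M / (m * x0)) + B * (y * M / (m * y0))"
        using AB ab2 by simp
      then show "pmean p x y \<le> A * M / (2 * x0) * x + B * M / (2 * y0) * y"
        using m assms by (simp add: field_simps flip: m_def)
    qed
  qed
qed

lemma pmean_superadditive:
  assumes "p \<le> 1" and "finite I"
    and pos: "\<And>i. i \<in> I \<Longrightarrow> f i > 0" "\<And>i. i \<in> I \<Longrightarrow> g i > 0"
    and c: "\<And>i. i \<in> I \<Longrightarrow> c i \<ge> 0"
    and sum: "(\<Sum>i\<in>I. c i * f i) > 0" "(\<Sum>i\<in>I. c i * g i) > 0"
  shows "(\<Sum>i\<in>I. c i * pmean p (f i) (g i)) \<le> pmean p (\<Sum>i\<in>I. c i * f i) (\<Sum>i\<in>I. c i * g i)"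
proof -
  obtain \<alpha> \<beta> where eq: "pmean p (\<Sum>i\<in>I. c i * f i) (\<Sum>i\<in>I. c i * g i)
        = \<alpha> * (\<Sum>i\<in>I. c i * f i) + \<beta> * (\<Sum>i\<in>I. c i * g i)"
    and le: "\<And>x y. x > 0 \<Longrightarrow> y > 0 \<Longrightarrow> pmean p x y \<le> \<alpha> * x + \<beta> * y"
    using pmean_tangent[OF \<open>p \<le> 1\<close> sum] by blast
  have "(\<Sum>i\<in>I. c i * pmean p (f i) (g i)) \<le> (\<Sum>i\<in>I. c i * (\<alpha> * f i + \<beta> * g i))"
    using pos c by (intro sum_mono mult_left_mono le)
  also have "\<dots> = \<alpha> * (\<Sum>i\<in>I. c i * f i) + \<beta> * (\<Sum>i\<in>I. c i * g i)"
    by (simp add: sum_distrib_left sum.distrib algebra_simps)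
  finally show ?thesis using eq by simp
qed

lemma pmean_uminus_inverse:
  assumes "p \<le> 1" "x > 0" "y > 0"
  shows "pmean (- p) (inverse x) (inverse y) = inverse (pmean p x y)"
proof -
  consider "p = -\<infinity>" | "p = 0" | r where "p = ereal r" "r \<noteq> 0"
    using assms by (cases p) (auto simp: zero_ereal_def one_ereal_def)
  then show ?thesis
  proof cases
    case 1
    then show ?thesis using assms by (auto simp: pmean_def min_def max_def field_simps)
  next
    case 2
    then show ?thesis using assms by (simp add: pmean_def real_sqrt_inverse flip: inverse_mult_distrib)
  next
    case 3
    have "inverse z powr (- r) = z powr r" if "z > 0" for z :: real
      using that by (simp add: powr_minus inverse_powr)
    with 3 assms show ?thesis by (simp add: pmean_def powr_minus)
  qed
qed

section \<open>Polyhedral cones and their extreme rays\<close>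

lemma extreme_rays_subset: "extreme_rays C \<subseteq> C \<inter> sphere 0 1"
  using face_of_imp_subset hull_subset[of _ conic] by (fastforce simp: extreme_rays_def)

lemma finite_extreme_rays:
  assumes "polyhedron C"
  shows "finite (extreme_rays C)"
proof (rule inj_on_finite)
  show "inj_on (\<lambda>u. conic hull {u}) (extreme_rays C)"
  proof (rule inj_onI)
    fix u w assume u: "u \<in> extreme_rays C" and w: "w \<in> extreme_rays C"
      and eq: "conic hull {u} = conic hull {w}"
    have "u \<in> conic hull {w}" using hull_inc[of u "{u}" conic] eq by simp
    then obtain c where "0 \<le> c" "u = c *\<^sub>R w" by (auto simp: conic_hull_explicit)
    then show "u = w" using u w by (simp add: extreme_rays_def)
  qed
  show "(\<lambda>u. conic hull {u}) ` extreme_rays C \<subseteq> {F. F face_of C}"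
    by (auto simp: extreme_rays_def)
  show "finite {F. F face_of C}" using assms by (rule finite_polyhedron_faces)
qed

text \<open>Cutting a pointed cone by the hyperplane at level 1 of a positive functional identifies its rays with
  the points of the slice: a segment in the cone through the ray of \<open>e\<close> projects radially to a
  segment in the slice through \<open>e\<close>, which must be degenerate.\<close>

lemma extreme_point_of_slice_imp_extreme_ray:
  assumes C: "conic C" "convex C" and pos: "\<And>v. v \<in> C \<Longrightarrow> v \<noteq> 0 \<Longrightarrow> x \<bullet> v > 0"
    and e: "e extreme_point_of (C \<inter> {v. x \<bullet> v = 1})"
  shows "e /\<^sub>R norm e \<in> extreme_rays C"
proof -
  have eC: "e \<in> C" and xe: "x \<bullet> e = 1" using e by (auto simp: extreme_point_of_def)
  then have "e \<noteq> 0" by auto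
  then have hull: "conic hull {e /\<^sub>R norm e} = conic hull {e}"
    using conic_hull_image_scale[of "{e}" "\<lambda>_. inverse (norm e)"] by simp
  have "conic hull {e} face_of C"
    unfolding face_of_def
  proof (intro conjI)
    show "conic hull {e} \<subseteq> C" using eC C by (simp add: hull_minimal)
    show "convex (conic hull {e})" by (simp add: convex_conic_hull)
    show "\<forall>a\<in>C. \<forall>b\<in>C. \<forall>z\<in>conic hull {e}. z \<in> open_segment a b \<longrightarrow>
        a \<in> conic hull {e} \<and> b \<in> conic hull {e}"
    proof (intro ballI impI)
      fix a b z
      assume a: "a \<in> C" and b: "b \<in> C" and "z \<in> conic hull {e}" and "z \<in> open_segment a b"
      then obtain c t where c: "0 \<le> c" "z = c *\<^sub>R e" and t: "0 < t" "t < 1"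
        and z: "z = (1 - t) *\<^sub>R a + t *\<^sub>R b"
        by (auto simp: conic_hull_explicit in_segment)
      have scaled: "w \<in> conic hull {e}" if "w = d *\<^sub>R e" "d \<ge> 0" for w d
        using that by (auto simp: conic_hull_explicit)
      consider "a = 0" | "b = 0" | "a \<noteq> 0" "b \<noteq> 0" by blast
      then show "a \<in> conic hull {e} \<and> b \<in> conic hull {e}"
      proof cases
        case 1
        then have "inverse t *\<^sub>R t *\<^sub>R b = inverse t *\<^sub>R c *\<^sub>R e" using c z by simp
        then have "b = (c / t) *\<^sub>R e" using t by (simp add: divide_inverse mult.commute)
        then show ?thesis using 1 scaled[of b "c / t"] scaled[of 0 0] c t by auto
      next
        case 2
        then have "(1 - t) *\<^sub>R a = c *\<^sub>R e" using c z by simp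
        then have "inverse (1 - t) *\<^sub>R (1 - t) *\<^sub>R a = inverse (1 - t) *\<^sub>R c *\<^sub>R e" by simp
        then have "a = (c / (1 - t)) *\<^sub>R e" using t by (simp add: divide_inverse mult.commute)
        then show ?thesis using 2 scaled[of a "c / (1 - t)"] scaled[of 0 0] c t by auto
      next
        case 3
        define \<alpha> \<beta> where "\<alpha> = x \<bullet> a" and "\<beta> = x \<bullet> b"
        have ab: "\<alpha> > 0" "\<beta> > 0" using pos a b 3 by (auto simp: \<alpha>_def \<beta>_def)
        have c_eq: "c = (1 - t) * \<alpha> + t * \<beta>"
          using arg_cong[OF z, of "inner x"] c xe by (simp add: \<alpha>_def \<beta>_def inner_add_right)
        then have "c > 0" using t ab by (simp add: add_pos_pos)
        have slice: "a /\<^sub>R \<alpha> \<in> C \<inter> {v. x \<bullet> v = 1}" "b /\<^sub>R \<beta> \<in> C \<inter> {v. x \<bullet> v = 1}"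
          using a b ab C by (auto simp: conic_mul \<alpha>_def \<beta>_def)
        \<comment> \<open>the weight of \<open>b\<close> after both endpoints and \<open>z\<close> are rescaled to level 1\<close>
        define s where "s = t * \<beta> / c"
        have s: "0 < s" "s < 1" using t ab \<open>c > 0\<close> c_eq by (auto simp: s_def)
        have "1 - s = (1 - t) * \<alpha> / c"
          using \<open>c > 0\<close> c_eq by (simp add: s_def field_simps)
        then have "(1 - s) * inverse \<alpha> = inverse c * (1 - t)" "s * inverse \<beta> = inverse c * t"
          using ab by (simp_all add: s_def divide_inverse)
        then have "(1 - s) *\<^sub>R (a /\<^sub>R \<alpha>) + s *\<^sub>R (b /\<^sub>R \<beta>) = z /\<^sub>R c"
          by (simp add: z scaleR_add_right)
        also have "\<dots> = e" using c \<open>c > 0\<close> by simp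
        finally have e_eq: "e = (1 - s) *\<^sub>R (a /\<^sub>R \<alpha>) + s *\<^sub>R (b /\<^sub>R \<beta>)" ..
        have "e \<notin> open_segment (a /\<^sub>R \<alpha>) (b /\<^sub>R \<beta>)"
          using e slice by (auto simp: extreme_point_of_def)
        then have eq: "a /\<^sub>R \<alpha> = b /\<^sub>R \<beta>" using e_eq s by (auto simp: in_segment)
        have "e = b /\<^sub>R \<beta>"
          using e_eq unfolding eq scaleR_left_distrib[symmetric] by simp
        then have "b = \<beta> *\<^sub>R e" using ab by simp
        moreover have "a = \<alpha> *\<^sub>R e"
          using \<open>e = b /\<^sub>R \<beta>\<close> ab unfolding eq[symmetric] by simp
        ultimately show ?thesis using scaled ab by (meson less_imp_le)
      qed
    qed
  qed
  then show ?thesis using hull \<open>e \<noteq> 0\<close> by (simp add: extreme_rays_def)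
qed

lemma compact_slice_of_cone:
  fixes C :: "'a::euclidean_space set"
  assumes C: "closed C" "conic C" and pos: "\<And>v. v \<in> C \<Longrightarrow> v \<noteq> 0 \<Longrightarrow> x \<bullet> v > 0"
  shows "compact (C \<inter> {v. x \<bullet> v = 1})"
proof -
  obtain \<delta> where \<delta>: "\<delta> > 0" "\<And>v. v \<in> C \<inter> sphere 0 1 \<Longrightarrow> \<delta> \<le> x \<bullet> v"
  proof (cases "C \<inter> sphere 0 1 = {}")
    case True
    then show thesis using that[of 1] by auto
  next
    case False
    have "compact (C \<inter> sphere 0 1)" using C(1) by (intro closed_Int_compact) auto
    moreover have "continuous_on (C \<inter> sphere 0 1) (inner x)" by (intro continuous_intros)
    ultimately obtain u where "u \<in> C \<inter> sphere 0 1" "\<And>v. v \<in> C \<inter> sphere 0 1 \<Longrightarrow> x \<bullet> u \<le> x \<bullet> v"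
      using continuous_attains_inf[OF _ False, of "inner x"] by blast
    moreover from this have "u \<noteq> 0" by auto
    ultimately show thesis using that[of "x \<bullet> u"] pos by auto
  qed
  have "norm v \<le> 1 / \<delta>" if "v \<in> C" "x \<bullet> v = 1" for v
  proof -
    have "v \<noteq> 0" using that by auto
    then have "v /\<^sub>R norm v \<in> C \<inter> sphere 0 1" using that C by (simp add: conic_mul)
    then have "\<delta> \<le> x \<bullet> (v /\<^sub>R norm v)" by (rule \<delta>)
    then show ?thesis using that \<open>v \<noteq> 0\<close> \<delta>(1) by (simp add: field_simps)
  qed
  then have "bounded (C \<inter> {v. x \<bullet> v = 1})" by (auto simp: bounded_iff)
  then show ?thesis using C by (simp add: compact_eq_bounded_closed closed_Int closed_hyperplane)
qed

text \<open>Minkowski's theorem for pointed cones, obtained from its version for compact convex sets applied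
  to the slice.\<close>

lemma cone_subset_convex_cone_hull_extreme_rays:
  assumes C: "closed C" "convex C" "conic C"
    and pos: "\<And>v. v \<in> C \<Longrightarrow> v \<noteq> 0 \<Longrightarrow> x \<bullet> v > 0"
  shows "C \<subseteq> convex_cone hull (extreme_rays C)"
proof
  let ?S = "C \<inter> {v. x \<bullet> v = 1}" and ?H = "convex_cone hull (extreme_rays C)"
  have "convex ?S" using C by (simp add: convex_Int convex_hyperplane)
  have "{e. e extreme_point_of ?S} \<subseteq> ?H"
  proof clarify
    fix e assume e: "e extreme_point_of ?S"
    then have "e \<noteq> 0" by (auto simp: extreme_point_of_def)
    moreover have "norm e *\<^sub>R (e /\<^sub>R norm e) \<in> ?H"
      by (intro convex_cone_hull_mul hull_inc
          extreme_point_of_slice_imp_extreme_ray[OF C(3,2) pos e]) auto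
    ultimately show "e \<in> ?H" by simp
  qed
  then have "convex hull {e. e extreme_point_of ?S} \<subseteq> ?H"
    by (simp add: hull_minimal convex_convex_cone_hull)
  then have slice: "?S \<subseteq> ?H"
    using Krein_Milman_Minkowski[OF compact_slice_of_cone[OF C(1,3) pos] \<open>convex ?S\<close>] by auto
  fix v assume v: "v \<in> C"
  show "v \<in> ?H"
  proof (cases "v = 0")
    case True
    then show ?thesis by (simp add: convex_cone_hull_contains_0)
  next
    case False
    then have "x \<bullet> v > 0" using pos v by blast
    then have "v /\<^sub>R (x \<bullet> v) \<in> ?S" using v C by (simp add: conic_mul)
    then have "v /\<^sub>R (x \<bullet> v) \<in> ?H" using slice by blast
    then have "(x \<bullet> v) *\<^sub>R (v /\<^sub>R (x \<bullet> v)) \<in> ?H"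
      using \<open>x \<bullet> v > 0\<close> by (rule convex_cone_hull_mul[OF _ less_imp_le])
    then show ?thesis using \<open>x \<bullet> v > 0\<close> by simp
  qed
qed

lemma convex_cone_hull_finite:
  assumes "finite T" and "v \<in> convex_cone hull T"
  obtains c where "\<And>t. t \<in> T \<Longrightarrow> 0 \<le> c t" "v = (\<Sum>t\<in>T. c t *\<^sub>R t)"
proof -
  let ?A = "{v. \<exists>c. (\<forall>t\<in>T. 0 \<le> c t) \<and> v = (\<Sum>t\<in>T. c t *\<^sub>R t)}"
  have "convex_cone hull T \<subseteq> ?A"
  proof (rule hull_minimal)
    show "T \<subseteq> ?A"
    proof
      fix u assume "u \<in> T"
      then have "u = (\<Sum>t\<in>T. (if t = u then 1 else 0) *\<^sub>R t)"
        using \<open>finite T\<close> by (simp add: if_distrib[of "\<lambda>c. c *\<^sub>R _"] cong: if_cong)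
      then show "u \<in> ?A"
        by (intro CollectI exI[of _ "\<lambda>t. if t = u then 1 else 0"]) auto
    qed
    show "convex_cone ?A"
      unfolding convex_cone_iff
    proof (intro conjI ballI allI impI)
      show "0 \<in> ?A" by (intro CollectI exI[of _ "\<lambda>_. 0"]) simp
    next
      fix a b assume "a \<in> ?A" "b \<in> ?A"
      then obtain c d where "\<forall>t\<in>T. 0 \<le> c t" "a = (\<Sum>t\<in>T. c t *\<^sub>R t)"
        "\<forall>t\<in>T. 0 \<le> d t" "b = (\<Sum>t\<in>T. d t *\<^sub>R t)" by blast
      then show "a + b \<in> ?A"
        by (intro CollectI exI[of _ "\<lambda>t. c t + d t"]) (simp add: scaleR_left_distrib sum.distrib)
    next
      fix a and d :: real assume "a \<in> ?A" "0 \<le> d"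
      then obtain c where "\<forall>t\<in>T. 0 \<le> c t" "a = (\<Sum>t\<in>T. c t *\<^sub>R t)" by blast
      then show "d *\<^sub>R a \<in> ?A" using \<open>0 \<le> d\<close>
        by (intro CollectI exI[of _ "\<lambda>t. d * c t"]) (simp add: scaleR_sum_right)
    qed
  qed
  then show thesis using assms(2) that by blast
qed

section \<open>Means of two functions that are linear on fans\<close>

text \<open>The fan is kept as a finite cover of the space by polyhedral cones, the pieces on which \<open>f\<close> is linear.
  Positivity of \<open>f\<close> forces each cone to be pointed, so that it is generated by its extreme rays.\<close>

definition linear_fan :: "('a::euclidean_space \<Rightarrow> real) \<Rightarrow> 'a set set \<Rightarrow> bool" where
  "linear_fan f \<C> \<longleftrightarrow> finite \<C> \<and> \<Union>\<C> = UNIV \<and> (\<forall>v. v \<noteq> 0 \<longrightarrow> f v > 0) \<and>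
     (\<forall>C\<in>\<C>. polyhedron C \<and> conic C \<and> (\<exists>x. \<forall>v\<in>C. f v = x \<bullet> v))"

definition refinement_rays :: "('a::euclidean_space) set set \<Rightarrow> 'a set set \<Rightarrow> 'a set" where
  "refinement_rays \<C> \<D> = (\<Union>C\<in>\<C>. \<Union>D\<in>\<D>. extreme_rays (C \<inter> D))"

lemma linear_fan_pos: "linear_fan f \<C> \<Longrightarrow> v \<noteq> 0 \<Longrightarrow> f v > 0"
  by (simp add: linear_fan_def)

lemma finite_refinement_rays:
  assumes "linear_fan f \<C>" and "linear_fan g \<D>"
  shows "finite (refinement_rays \<C> \<D>)"
  unfolding refinement_rays_def
  using assms by (intro finite_UN_I finite_extreme_rays polyhedron_Int) (auto simp: linear_fan_def)

lemma refinement_rays_subset_sphere: "refinement_rays \<C> \<D> \<subseteq> sphere 0 1"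
  using extreme_rays_subset by (fastforce simp: refinement_rays_def)

text \<open>The cone of the common refinement that contains \<open>v\<close> is generated by its extreme rays, and both \<open>f\<close>
  and \<open>g\<close> are additive on it; so superadditivity of \<open>pmean p\<close> passes to \<open>\<lambda>v. pmean p (f v) (g v)\<close>.\<close>

lemma pmean_ray_decomposition:
  assumes p: "p \<le> 1" and fan: "linear_fan f \<C>" "linear_fan g \<D>" and "v \<noteq> 0"
  shows "\<exists>T c. finite T \<and> T \<subseteq> refinement_rays \<C> \<D> \<and> (\<forall>t\<in>T. 0 \<le> c t) \<and>
    v = (\<Sum>t\<in>T. c t *\<^sub>R t) \<and> (\<Sum>t\<in>T. c t * pmean p (f t) (g t)) \<le> pmean p (f v) (g v)"
proof -
  have "v \<in> \<Union>\<C>" "v \<in> \<Union>\<D>" using fan by (simp_all add: linear_fan_def)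
  then obtain C D where CD: "C \<in> \<C>" "D \<in> \<D>" "v \<in> C" "v \<in> D" by blast
  obtain x where x: "\<And>u. u \<in> C \<Longrightarrow> f u = x \<bullet> u"
    using fan(1) CD(1) by (auto simp: linear_fan_def)
  obtain y where y: "\<And>u. u \<in> D \<Longrightarrow> g u = y \<bullet> u"
    using fan(2) CD(2) by (auto simp: linear_fan_def)
  have cone: "polyhedron (C \<inter> D)" "conic (C \<inter> D)"
    using CD fan by (auto simp: linear_fan_def conic_def)
  have "x \<bullet> u > 0" if "u \<in> C \<inter> D" "u \<noteq> 0" for u
    using that x[of u] linear_fan_pos[OF fan(1), of u] by simp
  then have "C \<inter> D \<subseteq> convex_cone hull (extreme_rays (C \<inter> D))"
    using cone by (intro cone_subset_convex_cone_hull_extreme_rays)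
      (auto simp: polyhedron_imp_closed polyhedron_imp_convex)
  then have v_hull: "v \<in> convex_cone hull (extreme_rays (C \<inter> D))" using CD by blast
  have fin: "finite (extreme_rays (C \<inter> D))" using cone by (simp add: finite_extreme_rays)
  obtain c where c: "\<And>t. t \<in> extreme_rays (C \<inter> D) \<Longrightarrow> 0 \<le> c t"
    and v: "v = (\<Sum>t\<in>extreme_rays (C \<inter> D). c t *\<^sub>R t)"
    using convex_cone_hull_finite[OF fin v_hull] by blast
  have ray: "t \<in> C" "t \<in> D" "t \<noteq> 0" if "t \<in> extreme_rays (C \<inter> D)" for t
    using that extreme_rays_subset[of "C \<inter> D"] by auto
  have "f v = x \<bullet> (\<Sum>t\<in>extreme_rays (C \<inter> D). c t *\<^sub>R t)" using x[OF CD(3)] by (subst v[symmetric])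
  then have f: "f v = (\<Sum>t\<in>extreme_rays (C \<inter> D). c t * f t)"
    using x ray by (simp add: inner_sum_right)
  have "g v = y \<bullet> (\<Sum>t\<in>extreme_rays (C \<inter> D). c t *\<^sub>R t)" using y[OF CD(4)] by (subst v[symmetric])
  then have g: "g v = (\<Sum>t\<in>extreme_rays (C \<inter> D). c t * g t)"
    using y ray by (simp add: inner_sum_right)
  have "f v > 0" "g v > 0" using fan \<open>v \<noteq> 0\<close> by (auto simp: linear_fan_pos)
  then have "(\<Sum>t\<in>extreme_rays (C \<inter> D). c t * pmean p (f t) (g t)) \<le> pmean p (f v) (g v)"
    unfolding f g using ray c fan
    by (intro pmean_superadditive[OF p fin]) (auto simp: linear_fan_pos)
  moreover have "extreme_rays (C \<inter> D) \<subseteq> refinement_rays \<C> \<D>"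
    using CD by (auto simp: refinement_rays_def)
  ultimately show ?thesis using fin c v by blast
qed

theorem pmean_constraints_reduce_to_rays:
  assumes "p \<le> 1" and fan: "linear_fan f \<C>" "linear_fan g \<D>"
  shows "{x. \<forall>a\<in>sphere 0 1. a \<bullet> x \<le> pmean p (f a) (g a)}
       = {x. \<forall>a\<in>refinement_rays \<C> \<D>. a \<bullet> x \<le> pmean p (f a) (g a)}"
proof (rule set_eqI, unfold mem_Collect_eq, rule iffI)
  fix x assume "\<forall>a\<in>sphere 0 1. a \<bullet> x \<le> pmean p (f a) (g a)"
  then show "\<forall>a\<in>refinement_rays \<C> \<D>. a \<bullet> x \<le> pmean p (f a) (g a)"
    using refinement_rays_subset_sphere by blast
next
  fix x assume x: "\<forall>a\<in>refinement_rays \<C> \<D>. a \<bullet> x \<le> pmean p (f a) (g a)"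
  show "\<forall>a\<in>sphere 0 1. a \<bullet> x \<le> pmean p (f a) (g a)"
  proof
    fix a :: 'a assume "a \<in> sphere 0 1"
    then have "a \<noteq> 0" by auto
    then obtain T c where "finite T" and T: "T \<subseteq> refinement_rays \<C> \<D>" "\<And>t. t \<in> T \<Longrightarrow> 0 \<le> c t"
      and a: "a = (\<Sum>t\<in>T. c t *\<^sub>R t)"
      and le: "(\<Sum>t\<in>T. c t * pmean p (f t) (g t)) \<le> pmean p (f a) (g a)"
      using pmean_ray_decomposition[OF \<open>p \<le> 1\<close> fan \<open>a \<noteq> 0\<close>] by blast
    have "a \<bullet> x = (\<Sum>t\<in>T. c t * (t \<bullet> x))" using a by (simp add: inner_sum_left)
    also have "\<dots> \<le> (\<Sum>t\<in>T. c t * pmean p (f t) (g t))"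
      using T x by (intro sum_mono mult_left_mono) auto
    finally show "a \<bullet> x \<le> pmean p (f a) (g a)" using le by simp
  qed
qed

text \<open>A decomposition of \<open>v\<close> into rays exhibits the point over \<open>v\<close> as a subconvex combination of the
  points over the rays; the missing weight is put on \<open>0\<close>.\<close>

theorem pmean_hull_reduces_to_rays:
  assumes "p \<le> 1" and fan: "linear_fan f \<C>" "linear_fan g \<D>"
  defines "w \<equiv> \<lambda>v. inverse (pmean p (f v) (g v)) *\<^sub>R v"
  shows "convex hull (w ` sphere 0 1) = convex hull (w ` refinement_rays \<C> \<D>)"
proof
  let ?R = "refinement_rays \<C> \<D>" and ?\<phi> = "\<lambda>v. pmean p (f v) (g v)"
  show "convex hull (w ` ?R) \<subseteq> convex hull (w ` sphere 0 1)"
    by (intro hull_mono image_mono refinement_rays_subset_sphere)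
  have pos: "?\<phi> v > 0" if "v \<noteq> 0" for v
    using that fan by (intro pmean_pos) (auto simp: linear_fan_pos)
  have Rpos: "?\<phi> t > 0" if "t \<in> ?R" for t
    using that refinement_rays_subset_sphere[of \<C> \<D>] by (intro pos) auto
  have w_scale: "t = ?\<phi> t *\<^sub>R w t" if "t \<in> ?R" for t
    using Rpos[OF that] by (simp add: w_def)
  \<comment> \<open>The rays generate the whole space as a cone, so no open half-space contains all of them.\<close>
  have zero: "0 \<in> convex hull (w ` ?R)"
  proof (rule ccontr)
    assume "0 \<notin> convex hull (w ` ?R)"
    moreover have "closed (convex hull (w ` ?R))"
      using finite_refinement_rays[OF fan] by (simp add: finite_imp_compact_convex_hull compact_imp_closed)
    ultimately obtain a b where a: "a \<noteq> 0" "0 < b" "\<And>z. z \<in> convex hull (w ` ?R) \<Longrightarrow> a \<bullet> z > b"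
      using separating_hyperplane_closed_0[of "convex hull (w ` ?R)"] by (auto simp: convex_convex_hull)
    have "- a \<noteq> 0" using a by simp
    then obtain T c where "finite T" and T: "T \<subseteq> ?R" "\<And>t. t \<in> T \<Longrightarrow> 0 \<le> c t"
      and sum: "- a = (\<Sum>t\<in>T. c t *\<^sub>R t)"
      and "(\<Sum>t\<in>T. c t * ?\<phi> t) \<le> ?\<phi> (- a)"
      using pmean_ray_decomposition[OF \<open>p \<le> 1\<close> fan \<open>- a \<noteq> 0\<close>] by blast
    have "0 \<le> a \<bullet> t" if "t \<in> ?R" for t
    proof -
      have "a \<bullet> t = ?\<phi> t * (a \<bullet> w t)"
        using w_scale[OF that] by (metis inner_scaleR_right)
      moreover have "a \<bullet> w t > b" using that by (intro a hull_inc) auto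
      ultimately show ?thesis using Rpos[OF that] a by simp
    qed
    then have "0 \<le> (\<Sum>t\<in>T. c t * (a \<bullet> t))" using T by (intro sum_nonneg mult_nonneg_nonneg) auto
    also have "\<dots> = a \<bullet> (- a)" unfolding sum by (simp add: inner_sum_right)
    finally have "a \<bullet> a \<le> 0" by simp
    moreover have "a \<bullet> a > 0" using a(1) by simp
    ultimately show False by linarith
  qed
  show "convex hull (w ` sphere 0 1) \<subseteq> convex hull (w ` ?R)"
  proof (rule hull_minimal)
    show "w ` sphere 0 1 \<subseteq> convex hull (w ` ?R)"
    proof clarify
      fix v :: 'a assume "v \<in> sphere 0 1"
      then have "v \<noteq> 0" by auto
      then obtain T c where T: "finite T" "T \<subseteq> ?R" and c: "\<And>t. t \<in> T \<Longrightarrow> 0 \<le> c t"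
        and v: "v = (\<Sum>t\<in>T. c t *\<^sub>R t)" and le: "(\<Sum>t\<in>T. c t * ?\<phi> t) \<le> ?\<phi> v"
        using pmean_ray_decomposition[OF \<open>p \<le> 1\<close> fan \<open>v \<noteq> 0\<close>] by blast
      define d where "d = (\<lambda>t. c t * ?\<phi> t / ?\<phi> v)"
      have d: "0 \<le> d t" if "t \<in> T" for t
        using c[OF that] T(2) that Rpos[of t] pos[OF \<open>v \<noteq> 0\<close>] by (auto simp: d_def)
      have d_sum: "sum d T \<le> 1"
        using le pos[OF \<open>v \<noteq> 0\<close>] by (simp add: d_def flip: sum_divide_distrib)
      have "w v = (\<Sum>t\<in>T. inverse (?\<phi> v) *\<^sub>R c t *\<^sub>R t)"
        unfolding w_def by (subst (3) v) (rule scaleR_sum_right)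
      also have "\<dots> = (\<Sum>t\<in>T. d t *\<^sub>R w t)"
      proof (rule sum.cong)
        fix t assume "t \<in> T"
        then have "c t *\<^sub>R t = (c t * ?\<phi> t) *\<^sub>R w t"
          using w_scale[of t] T by (metis scaleR_scaleR subsetD)
        then show "inverse (?\<phi> v) *\<^sub>R c t *\<^sub>R t = d t *\<^sub>R w t"
          by (simp add: d_def divide_inverse mult_ac)
      qed simp
      also have "\<dots> = (1 - sum d T) *\<^sub>R 0 + (\<Sum>t\<in>T. d t *\<^sub>R w t)" by simp
      also have "\<dots> \<in> convex hull (w ` ?R)"
      proof -
        \<comment> \<open>The index \<open>None\<close> stands for the extra point \<open>0\<close>.\<close>
        define q where "q = (\<lambda>t. case t of None \<Rightarrow> 0 | Some t \<Rightarrow> w t)"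
        define e where "e = (\<lambda>t. case t of None \<Rightarrow> 1 - sum d T | Some t \<Rightarrow> d t)"
        let ?I = "insert None (Some ` T)"
        have w_hull: "w t \<in> convex hull (w ` ?R)" if "t \<in> T" for t
          using that T by (intro hull_inc) auto
        have "(\<Sum>i\<in>?I. e i *\<^sub>R q i) \<in> convex hull (w ` ?R)"
        proof (rule convex_sum)
          show "sum e ?I = 1" using T by (simp add: e_def sum.reindex)
          show "q i \<in> convex hull (w ` ?R)" if "i \<in> ?I" for i
            using that zero w_hull by (auto simp: q_def)
        qed (use T d d_sum in \<open>auto simp: e_def convex_convex_hull\<close>)
        also have "(\<Sum>i\<in>?I. e i *\<^sub>R q i) = (1 - sum d T) *\<^sub>R 0 + (\<Sum>t\<in>T. d t *\<^sub>R w t)"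
          using T by (simp add: e_def q_def sum.reindex)
        finally show ?thesis .
      qed
      finally show "w v \<in> convex hull (w ` ?R)" .
    qed
  qed (simp add: convex_convex_hull)
qed

section \<open>The normal fan and the support function\<close>

lemma inner_le_support_fun:
  assumes "compact P" and "x \<in> P"
  shows "a \<bullet> x \<le> support_fun P a"
proof -
  have "compact ((\<bullet>) a ` P)"
    using assms by (intro compact_continuous_image continuous_intros)
  then show ?thesis
    unfolding support_fun_def using assms
    by (intro cSUP_upper bounded_imp_bdd_above compact_imp_bounded)
qed

lemma support_fun_attained_at_extreme_point:
  assumes "compact P" and "convex P" and "P \<noteq> {}"
  obtains x where "x extreme_point_of P" and "a \<bullet> x = support_fun P a"
proof -
  have "continuous_on P (inner a)" by (intro continuous_intros)
  then obtain z where z: "z \<in> P" "\<And>y. y \<in> P \<Longrightarrow> a \<bullet> y \<le> a \<bullet> z"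
    using continuous_attains_sup[OF assms(1,3), of "inner a"] by blast
  let ?F = "P \<inter> {y. a \<bullet> y = a \<bullet> z}"
  have "?F face_of P" using assms z by (simp add: face_of_Int_supporting_hyperplane_le)
  moreover have "compact ?F" "convex ?F" "?F \<noteq> {}"
    using assms z by (auto simp: compact_Int_closed closed_hyperplane convex_Int convex_hyperplane)
  then obtain x where "x extreme_point_of ?F" by (rule extreme_point_exists_convex)
  ultimately have x: "x extreme_point_of P" "a \<bullet> x = a \<bullet> z"
    by (auto simp: extreme_point_of_face)
  have "support_fun P a = a \<bullet> z"
    unfolding support_fun_def using z by (intro cSup_eq_maximum) auto
  with x show thesis by (intro that[of x]) simp_all
qed

text \<open>Comparing \<open>x\<close> with the extreme points alone suffices, since one of them attains the support
  function.  A polytope has finitely many, so its normal cones are polyhedral.\<close>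

lemma normal_cone_eq_halfspaces:
  assumes "compact P" and "convex P" and "x \<in> P"
  shows "normal_cone P x = (\<Inter>v\<in>{v. v extreme_point_of P}. {a. (v - x) \<bullet> a \<le> 0})"
proof (rule set_eqI)
  fix a
  have "P \<noteq> {}" using assms by auto
  then obtain v where v: "v extreme_point_of P" "a \<bullet> v = support_fun P a"
    by (rule support_fun_attained_at_extreme_point[OF assms(1,2)])
  have le: "a \<bullet> u \<le> support_fun P a" if "u \<in> P" for u
    using assms that by (simp add: inner_le_support_fun)
  have ext: "u \<in> P" if "u extreme_point_of P" for u
    using that by (simp add: extreme_point_of_def)
  show "a \<in> normal_cone P x \<longleftrightarrow> a \<in> (\<Inter>v\<in>{v. v extreme_point_of P}. {a. (v - x) \<bullet> a \<le> 0})"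
  proof
    assume "a \<in> normal_cone P x"
    then have "a \<bullet> x = support_fun P a" by (simp add: normal_cone_def)
    then show "a \<in> (\<Inter>v\<in>{v. v extreme_point_of P}. {a. (v - x) \<bullet> a \<le> 0})"
      using le[OF ext] by (simp add: inner_diff_left inner_commute[of _ a])
  next
    assume "a \<in> (\<Inter>v\<in>{v. v extreme_point_of P}. {a. (v - x) \<bullet> a \<le> 0})"
    then have "(v - x) \<bullet> a \<le> 0" using v(1) by blast
    then have "support_fun P a \<le> a \<bullet> x"
      using v(2) by (simp add: inner_diff_left inner_commute[of a])
    then show "a \<in> normal_cone P x"
      using le[OF \<open>x \<in> P\<close>] by (simp add: normal_cone_def)
  qed
qed

lemma convex_bodies0_cball:
  assumes "P \<in> convex_bodies0"
  obtains e where "e > 0" "cball 0 e \<subseteq> P"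
  using assms by (auto simp: convex_bodies0_def mem_interior_cball)

theorem linear_fan_support_fun:
  assumes "P \<in> convex_bodies0" and "polytope P"
  shows "linear_fan (support_fun P) (coarse_normal_fan P)"
  unfolding linear_fan_def
proof (intro conjI ballI allI impI)
  have P: "compact P" "convex P" "P \<noteq> {}"
    using assms(1) interior_subset by (auto simp: convex_bodies0_def)
  have fin: "finite {v. v extreme_point_of P}"
    using assms(2) by (simp add: finite_polyhedron_extreme_points polytope_imp_polyhedron)
  then show "finite (coarse_normal_fan P)"
    by (simp add: coarse_normal_fan_def setcompr_eq_image)
  have "\<exists>C\<in>coarse_normal_fan P. a \<in> C" for a
  proof -
    obtain x where "x extreme_point_of P" "a \<bullet> x = support_fun P a"
      by (rule support_fun_attained_at_extreme_point[OF P])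
    then show ?thesis by (auto simp: coarse_normal_fan_def normal_cone_def)
  qed
  then show "\<Union>(coarse_normal_fan P) = UNIV" by blast
  show "support_fun P v > 0" if "v \<noteq> 0" for v
  proof -
    obtain e where e: "e > 0" "cball 0 e \<subseteq> P" by (rule convex_bodies0_cball[OF assms(1)])
    have "(e / norm v) *\<^sub>R v \<in> P" using e that by (intro subsetD[OF e(2)]) simp
    then have "v \<bullet> ((e / norm v) *\<^sub>R v) \<le> support_fun P v" by (rule inner_le_support_fun[OF P(1)])
    moreover have "v \<bullet> ((e / norm v) *\<^sub>R v) > 0" using e that by simp
    ultimately show ?thesis by linarith
  qed
  fix C assume "C \<in> coarse_normal_fan P"
  then obtain x where x: "x extreme_point_of P" and C: "C = normal_cone P x"
    by (auto simp: coarse_normal_fan_def)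
  have C': "C = (\<Inter>v\<in>{v. v extreme_point_of P}. {a. (v - x) \<bullet> a \<le> 0})"
    unfolding C using x by (intro normal_cone_eq_halfspaces P) (simp add: extreme_point_of_def)
  show "polyhedron C" unfolding C' using fin by (intro polyhedron_Inter) (auto simp: polyhedron_halfspace_le)
  show "conic C" unfolding C' by (intro conic_Inter) (auto simp: conic_halfspace_le)
  show "\<exists>y. \<forall>a\<in>C. support_fun P a = y \<bullet> a"
    by (rule exI[of _ x]) (simp add: C normal_cone_def inner_commute)
qed

section \<open>The face fan and the gauge function\<close>

text \<open>The hyperplane of a facet misses the interior point \<open>0\<close>, so its level can be normalised to 1.\<close>

lemma facet_supporting_functional:
  assumes "P \<in> convex_bodies0" and "polytope P" and "F facet_of P"
  obtains a where "P \<subseteq> {x. a \<bullet> x \<le> 1}" and "F = P \<inter> {x. a \<bullet> x = 1}"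
proof -
  obtain a b where a: "a \<noteq> 0" "P \<subseteq> {x. a \<bullet> x \<le> b}" "F = P \<inter> {x. a \<bullet> x = b}"
    using facet_of_polyhedron[OF polytope_imp_polyhedron[OF assms(2)] assms(3)] by blast
  obtain e where e: "e > 0" "cball 0 e \<subseteq> P" by (rule convex_bodies0_cball[OF assms(1)])
  have "(e / norm a) *\<^sub>R a \<in> P" using e a by (intro subsetD[OF e(2)]) simp
  then have "a \<bullet> ((e / norm a) *\<^sub>R a) \<le> b" using a by blast
  moreover have "a \<bullet> ((e / norm a) *\<^sub>R a) > 0" using e a by simp
  ultimately have "b > 0" by linarith
  then show thesis using a(2,3)
    by (intro that[of "a /\<^sub>R b"]) (auto simp: field_simps)
qed

text \<open>The functional \<open>a\<close> certifies that \<open>x\<close> lies on the boundary: no smaller multiple of \<open>P\<close> reaches level \<open>s\<close>.\<close>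

lemma gauge_fun_scaleR:
  assumes "x \<in> P" and "\<And>y. y \<in> P \<Longrightarrow> a \<bullet> y \<le> 1" and "a \<bullet> x = 1" and "s \<ge> 0"
  shows "gauge_fun P (s *\<^sub>R x) = s"
  unfolding gauge_fun_def
proof (rule cInf_eq_minimum)
  show "s \<in> {l. 0 \<le> l \<and> s *\<^sub>R x \<in> (*\<^sub>R) l ` P}" using assms by auto
  fix l assume "l \<in> {l. 0 \<le> l \<and> s *\<^sub>R x \<in> (*\<^sub>R) l ` P}"
  then obtain y where "0 \<le> l" "y \<in> P" "s *\<^sub>R x = l *\<^sub>R y" by auto
  then have "a \<bullet> (s *\<^sub>R x) = l * (a \<bullet> y)" by simp
  also have "\<dots> \<le> l * 1" using \<open>0 \<le> l\<close> assms(2)[OF \<open>y \<in> P\<close>] by (rule mult_left_mono[rotated])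
  finally show "s \<le> l" using assms(3) by simp
qed

lemma ray_meets_facet:
  assumes "P \<in> convex_bodies0" and "polytope P" and "v \<noteq> 0"
  obtains F where "F facet_of P" and "v \<in> convex_cone hull F"
proof -
  have P: "compact P" "convex P" "0 \<in> interior P" using assms(1) by (auto simp: convex_bodies0_def)
  obtain d where d: "d > 0" "0 + d *\<^sub>R v \<in> frontier P"
    using ray_to_frontier[OF compact_imp_bounded[OF P(1)] P(3) assms(3)] by blast
  have "rel_interior P = interior P" using P by (intro rel_interior_nonempty_interior) auto
  then have "d *\<^sub>R v \<in> P - rel_interior P"
    using d P by (simp add: frontier_def compact_imp_closed closure_closed)
  then obtain F where F: "F facet_of P" "d *\<^sub>R v \<in> F"
    unfolding rel_boundary_of_polyhedron[OF polytope_imp_polyhedron[OF assms(2)]] by blast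
  have "inverse d *\<^sub>R (d *\<^sub>R v) \<in> convex_cone hull F"
    using d F by (intro convex_cone_hull_mul[of "d *\<^sub>R v"] hull_inc) simp_all
  then show thesis using F d by (intro that) simp_all
qed

theorem linear_fan_gauge_fun:
  assumes "P \<in> convex_bodies0" and "polytope P"
  shows "linear_fan (gauge_fun P) (coarse_face_fan P)"
proof -
  have facet: "\<exists>a. (\<forall>v\<in>convex_cone hull F. gauge_fun P v = a \<bullet> v \<and> (v \<noteq> 0 \<longrightarrow> a \<bullet> v > 0))"
    if "F facet_of P" for F
  proof -
    obtain a where a: "P \<subseteq> {x. a \<bullet> x \<le> 1}" "F = P \<inter> {x. a \<bullet> x = 1}"
      by (rule facet_supporting_functional[OF assms \<open>F facet_of P\<close>])
    have F: "convex F" "F \<noteq> {}"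
      using that face_of_imp_convex by (auto simp: facet_of_def)
    show ?thesis
    proof (intro exI ballI)
      fix v assume "v \<in> convex_cone hull F"
      then obtain s x where "x \<in> F" "s \<ge> 0" and v: "v = s *\<^sub>R x"
        using F by (auto simp: convex_cone_hull_convex_hull_nonempty hull_same)
      then have "gauge_fun P v = s" "a \<bullet> v = s"
        using a by (auto intro!: gauge_fun_scaleR[of _ _ a])
      then show "gauge_fun P v = a \<bullet> v \<and> (v \<noteq> 0 \<longrightarrow> a \<bullet> v > 0)"
        using v \<open>s \<ge> 0\<close> by (cases "s = 0") auto
    qed
  qed
  have cover: "\<exists>C\<in>coarse_face_fan P. v \<in> C" for v
  proof -
    obtain b :: 'a where "b \<in> Basis" using nonempty_Basis by blast
    \<comment> \<open>The origin lies in every cone of the fan, but some facet has to exist: take any that meets a basis vector.\<close>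
    define u where "u = (if v = 0 then b else v)"
    have "u \<noteq> 0" using \<open>b \<in> Basis\<close> by (auto simp: u_def)
    then obtain F where F: "F facet_of P" "u \<in> convex_cone hull F"
      by (rule ray_meets_facet[OF assms])
    then have "v \<in> convex_cone hull F"
      by (cases "v = 0") (simp_all add: u_def convex_cone_hull_contains_0)
    with F show ?thesis by (auto simp: coarse_face_fan_def)
  qed
  show ?thesis
    unfolding linear_fan_def
  proof (intro conjI ballI allI impI)
    show "finite (coarse_face_fan P)"
      using finite_polytope_facets[OF assms(2)] by (simp add: coarse_face_fan_def setcompr_eq_image)
    show "\<Union>(coarse_face_fan P) = UNIV" using cover by blast
    show "gauge_fun P v > 0" if "v \<noteq> 0" for v
    proof -
      obtain F where "F facet_of P" "v \<in> convex_cone hull F"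
        by (rule ray_meets_facet[OF assms \<open>v \<noteq> 0\<close>])
      with facet that show ?thesis by metis
    qed
    fix C assume "C \<in> coarse_face_fan P"
    then obtain F where F: "F facet_of P" and C: "C = convex_cone hull F"
      by (auto simp: coarse_face_fan_def)
    have "polytope F"
      using F assms(2) face_of_polytope_polytope facet_of_imp_face_of by blast
    then show "polyhedron C" unfolding C by (rule polyhedron_convex_cone_hull_polytope)
    show "conic C" unfolding C by (rule conic_convex_cone_hull)
    show "\<exists>y. \<forall>v\<in>C. gauge_fun P v = y \<bullet> v" using facet[OF F] C by blast
  qed
qed

section \<open>Means of polytopes\<close>

lemma bounded_sphere_constraints:
  fixes \<phi> :: "'a::euclidean_space \<Rightarrow> real"
  shows "bounded {x. \<forall>a\<in>sphere 0 1. a \<bullet> x \<le> \<phi> a}"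
proof (rule bounded_subset[OF bounded_cbox])
  show "{x. \<forall>a\<in>sphere 0 1. a \<bullet> x \<le> \<phi> a}
      \<subseteq> cbox (- (\<Sum>i\<in>Basis. \<phi> (- i) *\<^sub>R i)) (\<Sum>i\<in>Basis. \<phi> i *\<^sub>R i)"
  proof
    fix x :: 'a assume x: "x \<in> {x. \<forall>a\<in>sphere 0 1. a \<bullet> x \<le> \<phi> a}"
    have "- \<phi> (- i) \<le> x \<bullet> i \<and> x \<bullet> i \<le> \<phi> i" if "i \<in> Basis" for i
    proof -
      from that have "i \<in> sphere 0 1" "- i \<in> sphere 0 1" by simp_all
      with x have "i \<bullet> x \<le> \<phi> i" "- i \<bullet> x \<le> \<phi> (- i)" by blast+
      then show ?thesis by (simp add: inner_commute)
    qed
    then show "x \<in> cbox (- (\<Sum>i\<in>Basis. \<phi> (- i) *\<^sub>R i)) (\<Sum>i\<in>Basis. \<phi> i *\<^sub>R i)"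
      by (simp add: mem_box)
  qed
qed

theorem theorem1p7:
  fixes K L :: "(real ^ 'n) set" and p :: ereal
  assumes "K \<in> convex_bodies0" and "L \<in> convex_bodies0"
    and "polytope K" and "polytope L"
    and "p \<le> 1"
  shows "polytope (upper_pmean p K L)
     \<and> polytope (lower_pmean (- p) K L)
     \<and> upper_pmean p K L =
      {x. \<forall>a \<in> (\<Union>N\<^sub>K\<in>coarse_normal_fan K. \<Union>N\<^sub>L\<in>coarse_normal_fan L. extreme_rays (N\<^sub>K \<inter> N\<^sub>L)).
            a \<bullet> x \<le> pmean p (support_fun K a) (support_fun L a)}
     \<and> lower_pmean (- p) K L =
      convex hull ((\<lambda>v. pmean (- p) (inverse (gauge_fun K v)) (inverse (gauge_fun L v)) *\<^sub>R v) `
        (\<Union>F\<^sub>K\<in>coarse_face_fan K. \<Union>F\<^sub>L\<in>coarse_face_fan L. extreme_rays (F\<^sub>K \<inter> F\<^sub>L)))"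
proof -
  let ?\<phi> = "\<lambda>a. pmean p (support_fun K a) (support_fun L a)"
  let ?N = "refinement_rays (coarse_normal_fan K) (coarse_normal_fan L)"
  note N_fans = linear_fan_support_fun[OF assms(1,3)] linear_fan_support_fun[OF assms(2,4)]
  have upper: "upper_pmean p K L = {x. \<forall>a\<in>?N. a \<bullet> x \<le> ?\<phi> a}"
    unfolding upper_pmean_def by (rule pmean_constraints_reduce_to_rays[OF \<open>p \<le> 1\<close> N_fans])
  have "{x. \<forall>a\<in>?N. a \<bullet> x \<le> ?\<phi> a} = (\<Inter>a\<in>?N. {x. a \<bullet> x \<le> ?\<phi> a})" by auto
  then have "polyhedron (upper_pmean p K L)"
    unfolding upper using finite_refinement_rays[OF N_fans]
    by (auto intro!: polyhedron_Inter polyhedron_halfspace_le)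
  moreover have "bounded (upper_pmean p K L)"
    unfolding upper_pmean_def by (rule bounded_sphere_constraints)
  ultimately have upper_polytope: "polytope (upper_pmean p K L)"
    by (simp add: polytope_eq_bounded_polyhedron)

  let ?F = "refinement_rays (coarse_face_fan K) (coarse_face_fan L)"
  let ?w = "\<lambda>v. pmean (- p) (inverse (gauge_fun K v)) (inverse (gauge_fun L v)) *\<^sub>R v"
  note F_fans = linear_fan_gauge_fun[OF assms(1,3)] linear_fan_gauge_fun[OF assms(2,4)]
  have w: "?w ` S = (\<lambda>v. inverse (pmean p (gauge_fun K v) (gauge_fun L v)) *\<^sub>R v) ` S"
    if "S \<subseteq> sphere 0 1" for S
  proof (rule image_cong)
    fix v assume "v \<in> S"
    then have "v \<noteq> 0" using that by auto
    then show "?w v = inverse (pmean p (gauge_fun K v) (gauge_fun L v)) *\<^sub>R v"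
      using \<open>p \<le> 1\<close> F_fans by (simp add: pmean_uminus_inverse linear_fan_pos)
  qed simp
  have lower: "lower_pmean (- p) K L = convex hull (?w ` ?F)"
    unfolding lower_pmean_def w[OF order_refl] w[OF refinement_rays_subset_sphere]
    by (rule pmean_hull_reduces_to_rays[OF \<open>p \<le> 1\<close> F_fans])
  then have lower_polytope: "polytope (lower_pmean (- p) K L)"
    using finite_refinement_rays[OF F_fans] by (simp add: polytope_convex_hull)
  show ?thesis
    using upper_polytope lower_polytope upper lower unfolding refinement_rays_def by blast
qed

end
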